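(* Let $n\ge 2$, let $A$ be the adjacency matrix of the path $P_n$, and let $a,b$ be distinct vertices of $P_n$. PST under $A^2$ from $a$ to $b$ occurs if and only if \[ (n;a,b)=(3;1,3),\qquad (n;a,b)=(5;2,4),\qquad\text{or}\qquad (n;a,b)=(7;2,6), \] up to interchanging $a$ and $b$. The corresponding minimum positive transfer times under $A^2$ are respectively $\pi/2$, $\pi/2$, and $\pi/\sqrt2$.
   Context: $P_n$ is the path with vertices $1,2,\ldots,n$, where $i$ and $j$ are adjacent iff $|i-j|=1$. A real symmetric matrix $K$ indexed by a finite vertex set has perfect state transfer (PST) from vertex $a$ to vertex $b$ at time $\tau>0$ (a transfer time) if $\exp(-\mathrm i\tau K)e_a=\gamma e_b$ for some $\gamma\in\mathbb C$ with $|\gamma|=1$, where $e_v$ is the standard basis vector indexed by $v$; PST under $K$ from $a$ to $b$ occurs if this holds for some $\tau>0$. *)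

theory Defs
  imports Complex_Main "Jordan_Normal_Form.Matrix"
begin

text \<open>Vertices are numbered from 1, whereas the rows and columns of
  a \<open>mat\<close> are numbered from 0: vertex \<open>v\<close> corresponds to index \<open>v - 1\<close>.\<close>

definition path_adjacent :: "nat \<Rightarrow> nat \<Rightarrow> bool" where
  "path_adjacent i j \<longleftrightarrow> \<bar>int i - int j\<bar> = 1"

definition path_adj_mat :: "nat \<Rightarrow> real mat" where
  "path_adj_mat n = mat n n (\<lambda>(i, j). if path_adjacent (i + 1) (j + 1) then 1 else 0)"

definition vertex_vec :: "nat \<Rightarrow> nat \<Rightarrow> complex vec" where
  "vertex_vec n v = unit_vec n (v - 1)"

text \<open>The exponential series of a square matrix, summed entrywise; it always converges
  (lemma \<open>summable_mat_exp\<close> below).\<close>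

definition mat_exp :: "complex mat \<Rightarrow> complex mat" where
  "mat_exp M = mat (dim_row M) (dim_row M)
     (\<lambda>(i, j). \<Sum>k. (M ^\<^sub>m k) $$ (i, j) / fact k)"

text \<open>The next three notions are meant for a symmetric \<open>K\<close> (cf. lemma \<open>path_adj_mat_sq_symmetric\<close>)
  and \<open>a, b \<in> {1..dim_row K}\<close>.\<close>

definition transfer_time :: "real mat \<Rightarrow> nat \<Rightarrow> nat \<Rightarrow> real \<Rightarrow> bool" where
  "transfer_time K a b \<tau> \<longleftrightarrow> \<tau> > 0 \<and>
     (\<exists>\<gamma>. cmod \<gamma> = 1 \<and>
        mat_exp ((- \<i> * complex_of_real \<tau>) \<cdot>\<^sub>m map_mat complex_of_real K) *\<^sub>v vertex_vec (dim_row K) a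
          = \<gamma> \<cdot>\<^sub>v vertex_vec (dim_row K) b)"

definition PST :: "real mat \<Rightarrow> nat \<Rightarrow> nat \<Rightarrow> bool" where
  "PST K a b \<longleftrightarrow> (\<exists>\<tau>. transfer_time K a b \<tau>)"

definition min_transfer_time :: "real mat \<Rightarrow> nat \<Rightarrow> nat \<Rightarrow> real \<Rightarrow> bool" where
  "min_transfer_time K a b \<tau> \<longleftrightarrow>
     transfer_time K a b \<tau> \<and> (\<forall>\<tau>'. transfer_time K a b \<tau>' \<longrightarrow> \<tau> \<le> \<tau>')"

lemma path_adj_mat_sq_symmetric:
  "transpose_mat (path_adj_mat n ^\<^sub>m 2) = path_adj_mat n ^\<^sub>m 2"
proof -
  have c: "path_adj_mat n \<in> carrier_mat n n"
    by (simp add: path_adj_mat_def)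
  have t: "transpose_mat (path_adj_mat n) = path_adj_mat n"
    by (rule eq_matI) (auto simp: path_adj_mat_def path_adjacent_def)
  have "path_adj_mat n ^\<^sub>m 2 = path_adj_mat n * path_adj_mat n"
    using c by (simp add: numeral_2_eq_2)
  then show ?thesis
    using transpose_mult[OF c c] t by simp
qed

lemma summable_mat_exp:
  fixes M :: "complex mat"
  assumes M: "M \<in> carrier_mat n n" and ij: "i < n" "j < n"
  shows "summable (\<lambda>k. (M ^\<^sub>m k) $$ (i, j) / fact k)"
proof -
  define B where "B = (\<Sum>i<n. \<Sum>j<n. cmod (M $$ (i, j)))"
  have B0: "B \<ge> 0" by (auto simp: B_def intro!: sum_nonneg)
  have B: "(\<Sum>l<n. cmod (M $$ (l, j))) \<le> B" if "j < n" for j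
    unfolding B_def using that by (intro sum_mono member_le_sum) auto
  have bound: "cmod ((M ^\<^sub>m k) $$ (i, j)) \<le> B ^ k" if "i < n" "j < n" for i j k
    using that
  proof (induction k arbitrary: i j)
    case 0
    then show ?case using M by auto
  next
    case (Suc k)
    have P: "M ^\<^sub>m k \<in> carrier_mat n n" using M by (rule pow_carrier_mat)
    have "(M ^\<^sub>m Suc k) $$ (i, j) = (\<Sum>l<n. (M ^\<^sub>m k) $$ (i, l) * M $$ (l, j))"
      using P M Suc.prems by (simp add: scalar_prod_def lessThan_atLeast0)
    then have "cmod ((M ^\<^sub>m Suc k) $$ (i, j)) \<le> (\<Sum>l<n. B ^ k * cmod (M $$ (l, j)))"
      using Suc by (auto simp: norm_mult intro!: sum_norm_le mult_right_mono)
    also have "\<dots> = B ^ k * (\<Sum>l<n. cmod (M $$ (l, j)))"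
      by (simp add: sum_distrib_left)
    also have "\<dots> \<le> B ^ k * B"
      using B[OF Suc.prems(2)] B0 by (intro mult_left_mono) auto
    finally show ?case by (simp add: mult.commute)
  qed
  have "summable (\<lambda>k. B ^ k / fact k)"
    using summable_exp[of B] by (simp add: field_simps)
  then show ?thesis
    by (rule summable_comparison_test'[where N = 0])
      (use bound ij in \<open>auto simp: norm_divide intro!: divide_right_mono\<close>)
qed

end

theory Submission
  imports Defs
begin

text \<open>
  With \<open>N = n + 1\<close>, the vectors \<open>j \<mapsto> sin (k j \<pi> / N)\<close> are eigenvectors of \<open>A\<^sup>2\<close> for
  \<open>2 + 2 cos (2 k \<pi> / N)\<close>. Perfect state transfer at time \<open>\<tau>\<close> makes their entries at \<open>a\<close> and \<open>b\<close>
  agree up to phases that depend only on the eigenvalue. The case \<open>k = 1\<close> forces \<open>a + b = N\<close>, and comparing \<open>k = 1\<close> with \<open>k = n\<close>, which share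
  their eigenvalue, forces \<open>N = 2 m\<close>. With \<open>c k = cos (k \<pi> / m)\<close>, each number \<open>2 \<tau> (c 1 - c k)\<close> is then an
  integer multiple of \<open>\<pi>\<close> of parity \<open>k + 1\<close>, provided that the \<open>k\<close>-th eigenvector does not vanish at \<open>a\<close>.
  The recurrence \<open>2 c 1 * c k = c (k - 1) + c (k + 1)\<close> turns finitely many of these conditions into the
  rationality of \<open>2 cos (\<pi> / m)\<close> unless \<open>(m, a)\<close> is one of the three examples. Rationality means \<open>m \<le> 3\<close>,
  and parity settles what is left. The phase condition for \<open>k = 2\<close> bounds the transfer times from below.
\<close>

section \<open>Matrix exponentials and eigenvectors\<close>

lemma pow_mat_commute:
  assumes "M \<in> carrier_mat n n"
  shows "M ^\<^sub>m k * M = M * M ^\<^sub>m k"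
proof (induction k)
  case 0
  then show ?case using assms by simp
next
  case (Suc k)
  have "M ^\<^sub>m Suc k * M = (M * M ^\<^sub>m k) * M"
    using Suc by simp
  also have "\<dots> = M * (M ^\<^sub>m k * M)"
    using assms by (intro assoc_mult_mat) auto
  finally show ?case by simp
qed

lemma transpose_pow_mat:
  fixes M :: "'a :: comm_semiring_1 mat"
  assumes "M \<in> carrier_mat n n"
  shows "transpose_mat (M ^\<^sub>m k) = transpose_mat M ^\<^sub>m k"
proof (induction k)
  case 0
  then show ?case using assms by (simp add: transpose_one)
next
  case (Suc k)
  then show ?case
    using transpose_mult[of "M ^\<^sub>m k" n n M n] pow_mat_commute[of "transpose_mat M" n k] assms
    by simp
qed

lemma mat_exp_carrier:
  "M \<in> carrier_mat n n \<Longrightarrow> mat_exp M \<in> carrier_mat n n"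
  by (simp add: mat_exp_def)

text \<open>Symmetry of a matrix thus passes to its exponential, so the column prescribed by perfect
  state transfer is also known as a row.\<close>

lemma transpose_mat_exp:
  assumes "M \<in> carrier_mat n n"
  shows "transpose_mat (mat_exp M) = mat_exp (transpose_mat M)"
proof (rule eq_matI)
  fix i j assume "i < dim_row (mat_exp (transpose_mat M))" "j < dim_col (mat_exp (transpose_mat M))"
  then have ij: "i < n" "j < n" using assms by (auto simp: mat_exp_def)
  have "(M ^\<^sub>m k) $$ (j, i) = (transpose_mat M ^\<^sub>m k) $$ (i, j)" for k
    using ij assms by (simp flip: transpose_pow_mat)
  then show "transpose_mat (mat_exp M) $$ (i, j) = mat_exp (transpose_mat M) $$ (i, j)"
    using ij assms by (simp add: mat_exp_def)
qed (use assms in \<open>auto simp: mat_exp_def\<close>)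

lemma pow_mat_eigenvector:
  fixes M :: "'a :: field mat"
  assumes M: "M \<in> carrier_mat n n" and v: "v \<in> carrier_vec n" and eig: "M *\<^sub>v v = \<mu> \<cdot>\<^sub>v v"
  shows "M ^\<^sub>m k *\<^sub>v v = \<mu> ^ k \<cdot>\<^sub>v v"
proof (induction k)
  case 0
  then show ?case using M v by simp
next
  case (Suc k)
  have "M ^\<^sub>m Suc k *\<^sub>v v = M ^\<^sub>m k *\<^sub>v (M *\<^sub>v v)"
    using M v by (simp add: assoc_mult_mat_vec[of _ n n _ n])
  then show ?case
    using M v Suc by (simp add: eig mult_mat_vec[of _ n n] smult_smult_assoc)
qed

text \<open>Applied entry by entry, the series becomes \<open>v $ i\<close> times the exponential
  series of \<open>\<mu>\<close>. The finite sum over \<open>j\<close> commutes with the limit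
  because each entry series converges.\<close>

lemma mat_exp_eigenvector:
  assumes M: "M \<in> carrier_mat n n" and v: "v \<in> carrier_vec n" and eig: "M *\<^sub>v v = \<mu> \<cdot>\<^sub>v v"
  shows "mat_exp M *\<^sub>v v = exp \<mu> \<cdot>\<^sub>v v"
proof (rule eq_vecI)
  fix i assume "i < dim_vec (exp \<mu> \<cdot>\<^sub>v v)"
  then have i: "i < n" using v by simp
  have "(\<Sum>j<n. (M ^\<^sub>m k) $$ (i, j) * v $ j) = \<mu> ^ k * v $ i" for k
    using arg_cong[OF pow_mat_eigenvector[OF assms, of k], of "\<lambda>w. w $ i"] i M v
    by (simp add: scalar_prod_def lessThan_atLeast0)
  then have "(\<Sum>j<n. (M ^\<^sub>m k) $$ (i, j) / fact k * v $ j) = v $ i * (\<mu> ^ k /\<^sub>R fact k)" for k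
    by (simp add: scaleR_conv_of_real field_simps flip: sum_divide_distrib)
  moreover have "(\<lambda>k. v $ i * (\<mu> ^ k /\<^sub>R fact k)) sums (v $ i * exp \<mu>)"
    by (intro sums_mult exp_converges)
  ultimately have "(\<lambda>k. \<Sum>j<n. (M ^\<^sub>m k) $$ (i, j) / fact k * v $ j) sums (v $ i * exp \<mu>)"
    by simp
  moreover have "(\<lambda>k. \<Sum>j<n. (M ^\<^sub>m k) $$ (i, j) / fact k * v $ j) sums
      (\<Sum>j<n. (\<Sum>k. (M ^\<^sub>m k) $$ (i, j) / fact k) * v $ j)"
    using summable_mat_exp[OF M i] by (intro sums_sum sums_mult2 summable_sums) auto
  ultimately have "(\<Sum>j<n. (\<Sum>k. (M ^\<^sub>m k) $$ (i, j) / fact k) * v $ j) = v $ i * exp \<mu>"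
    by (rule sums_unique2[symmetric])
  then show "(mat_exp M *\<^sub>v v) $ i = (exp \<mu> \<cdot>\<^sub>v v) $ i"
    using M v i by (simp add: mat_exp_def scalar_prod_def lessThan_atLeast0 mult.commute)
qed (use assms in \<open>auto simp: mat_exp_def\<close>)

section \<open>Path adjacency matrices acting on vectors\<close>

lemma path_adj_mat_carrier: "path_adj_mat n \<in> carrier_mat n n"
  by (simp add: path_adj_mat_def)

lemma path_adj_mat_sq_carrier: "path_adj_mat n ^\<^sub>m 2 \<in> carrier_mat n n"
  by (rule pow_carrier_mat[OF path_adj_mat_carrier])

lemma path_adj_mat_mult_vec:
  assumes v: "v \<in> carrier_vec n" and i: "i < n"
  shows "(path_adj_mat n *\<^sub>v v) $ i =
    (if 0 < i then v $ (i - 1) else 0) + (if i + 1 < n then v $ (i + 1) else 0)"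
proof -
  have "(path_adj_mat n *\<^sub>v v) $ i = (\<Sum>j<n. (if path_adjacent (i + 1) (j + 1) then 1 else 0) * v $ j)"
    using assms by (simp add: path_adj_mat_def scalar_prod_def lessThan_atLeast0)
  \<comment> \<open>For \<open>i = 0\<close> the truncated \<open>i - 1\<close> is 0; the inner
    guard removes this spurious neighbour.\<close>
  also have "\<dots> = (\<Sum>j<n. (if j = i - 1 then if 0 < i then v $ (i - 1) else 0 else 0)
      + (if j = i + 1 then v $ (i + 1) else 0))"
    by (rule sum.cong) (auto simp: path_adjacent_def)
  finally show ?thesis
    using i by (simp add: sum.distrib)
qed

text \<open>Serves the explicit examples: the neighbour rule is applied twice, entry by entry, in
  place of multiplying out the square.\<close>

lemma path_adj_mat_sq_eigenvector:
  assumes "v \<in> carrier_vec n"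
    and "\<And>i. i < n \<Longrightarrow>
      (path_adj_mat n *\<^sub>v (path_adj_mat n *\<^sub>v v)) $ i = \<rho> * v $ i"
  shows "path_adj_mat n ^\<^sub>m 2 *\<^sub>v v = \<rho> \<cdot>\<^sub>v v"
  using assms path_adj_mat_carrier[of n]
  by (intro eq_vecI) (auto simp: numeral_2_eq_2 assoc_mult_mat_vec[of _ n n _ n])

section \<open>Perfect state transfer tested on eigenvectors\<close>

lemma smult_mat_mult_vec:
  assumes "A \<in> carrier_mat nr nc" "v \<in> carrier_vec nc"
  shows "(c \<cdot>\<^sub>m A) *\<^sub>v v = c \<cdot>\<^sub>v (A *\<^sub>v v)"
  using assms by (intro eq_vecI) (auto simp: smult_scalar_prod_distrib[of _ nc])

lemma transfer_eigenvector:
  assumes K: "K \<in> carrier_mat n n" and u: "u \<in> carrier_vec n" and eig: "K *\<^sub>v u = \<rho> \<cdot>\<^sub>v u"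
  shows "mat_exp ((- \<i> * complex_of_real \<tau>) \<cdot>\<^sub>m map_mat complex_of_real K) *\<^sub>v map_vec complex_of_real u
    = cis (- \<tau> * \<rho>) \<cdot>\<^sub>v map_vec complex_of_real u"
proof -
  let ?c = "- \<i> * complex_of_real \<tau>"
  have "map_mat complex_of_real K *\<^sub>v map_vec complex_of_real u = complex_of_real \<rho> \<cdot>\<^sub>v map_vec complex_of_real u"
    using of_real_hom.mult_mat_vec_hom[OF K u, where 'a = complex] eig
    by (simp add: of_real_hom.vec_hom_smult)
  then have "(?c \<cdot>\<^sub>m map_mat complex_of_real K) *\<^sub>v map_vec complex_of_real u
      = (?c * complex_of_real \<rho>) \<cdot>\<^sub>v map_vec complex_of_real u"
    using K u by (simp add: smult_mat_mult_vec[of _ n n] smult_smult_assoc)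
  from mat_exp_eigenvector[of _ n, OF _ _ this] show ?thesis
    using K u by (simp add: cis_conv_exp mult.assoc)
qed

text \<open>The exponential \<open>E\<close> is symmetric, so its row at \<open>a\<close> is
  \<open>\<gamma>\<close> times the unit vector at \<open>b\<close>. Pairing this row with an
  eigenvector, on which \<open>E\<close> acts as a phase, gives the relation, with one
  \<open>\<gamma>\<close> for all eigenvectors.\<close>

lemma transfer_time_eigenvectors:
  assumes K: "K \<in> carrier_mat n n" and sym: "transpose_mat K = K"
    and ab: "a \<in> {1..n}" "b \<in> {1..n}" and tr: "transfer_time K a b \<tau>"
  obtains \<gamma> where "cmod \<gamma> = 1" and "\<And>u \<rho>. u \<in> carrier_vec n \<Longrightarrow> K *\<^sub>v u = \<rho> \<cdot>\<^sub>v u \<Longrightarrow>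
    cis (- \<tau> * \<rho>) * complex_of_real (u $ (a - 1)) = \<gamma> * complex_of_real (u $ (b - 1))"
proof -
  define E where "E = mat_exp ((- \<i> * complex_of_real \<tau>) \<cdot>\<^sub>m map_mat complex_of_real K)"
  have E: "E \<in> carrier_mat n n"
    unfolding E_def using K by (intro mat_exp_carrier) simp
  have "transpose_mat ((- \<i> * complex_of_real \<tau>) \<cdot>\<^sub>m map_mat complex_of_real K)
      = (- \<i> * complex_of_real \<tau>) \<cdot>\<^sub>m map_mat complex_of_real (transpose_mat K)"
    using K by (intro eq_matI) auto
  then have Et: "transpose_mat E = E"
    unfolding E_def using K sym by (subst transpose_mat_exp[of _ n]) auto
  obtain \<gamma> where norm: "cmod \<gamma> = 1" and \<gamma>: "E *\<^sub>v unit_vec n (a - 1) = \<gamma> \<cdot>\<^sub>v unit_vec n (b - 1)"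
    using tr K unfolding transfer_time_def E_def vertex_vec_def by auto
  have Ea: "E $$ (a - 1, j) = (if j = b - 1 then \<gamma> else 0)" if "j < n" for j
  proof -
    have "E $$ (a - 1, j) = E $$ (j, a - 1)"
      using index_transpose_mat(1)[of "a - 1" E j] E ab that Et by auto
    also have "\<dots> = (E *\<^sub>v unit_vec n (a - 1)) $ j"
      using E ab that by (subst index_mult_mat_vec) (auto simp: scalar_prod_right_unit[of _ n])
    also have "\<dots> = (\<gamma> \<cdot>\<^sub>v unit_vec n (b - 1)) $ j"
      by (simp only: \<gamma>)
    finally show ?thesis
      using ab that by (simp add: unit_vec_def)
  qed
  show ?thesis
  proof (rule that[OF norm])
    fix u \<rho> assume u: "u \<in> carrier_vec n" and eig: "K *\<^sub>v u = \<rho> \<cdot>\<^sub>v u"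
    have "(E *\<^sub>v map_vec complex_of_real u) $ (a - 1)
        = (\<Sum>j<n. E $$ (a - 1, j) * complex_of_real (u $ j))"
      using E u ab by (subst index_mult_mat_vec) (auto simp: scalar_prod_def lessThan_atLeast0)
    also have "\<dots> = (\<Sum>j<n. if j = b - 1 then \<gamma> * complex_of_real (u $ j) else 0)"
      by (intro sum.cong refl, subst Ea) auto
    also have "\<dots> = \<gamma> * complex_of_real (u $ (b - 1))"
      using ab by auto
    finally show "cis (- \<tau> * \<rho>) * complex_of_real (u $ (a - 1)) = \<gamma> * complex_of_real (u $ (b - 1))"
      using transfer_eigenvector[OF K u eig, of \<tau>] u ab unfolding E_def by auto
  qed
qed

section \<open>Rationality of cosines\<close>

lemma cos_multiple_recurrence:
  fixes \<theta> :: real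
  shows "cos (real (Suc (Suc k)) * \<theta>) = 2 * cos \<theta> * cos (real (Suc k) * \<theta>) - cos (real k * \<theta>)"
proof -
  have "real (Suc (Suc k)) * \<theta> = real (Suc k) * \<theta> + \<theta>" "real k * \<theta> = real (Suc k) * \<theta> - \<theta>"
    by (simp_all add: algebra_simps)
  then show ?thesis by (simp only: cos_add cos_diff) simp
qed

text \<open>For \<open>k \<ge> 1\<close>, \<open>2 * cos (k * pi / m)\<close> is a monic integer
  polynomial in \<open>2 * cos (pi / m)\<close>. Its value for \<open>k = m\<close> is -2, so a
  rational \<open>2 * cos (pi / m)\<close> is an integer, as in the rational root theorem. For
  \<open>m \<ge> 4\<close> it would lie strictly between 1 and 2.\<close>

lemma two_cos_rational:
  fixes m :: nat
  assumes m: "m > 0" and x: "2 * cos (pi / m) \<in> \<rat>"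
  shows "m \<le> 3"
proof -
  define C where "C k = 2 * cos (real k * (pi / m))" for k :: nat
  obtain p q :: int where q: "q > 0" "coprime p q" and pq: "2 * cos (pi / m) = p / q"
    using x by (rule Rats_cases')
  have C_rec: "C (Suc (Suc k)) = (p / q) * C (Suc k) - C k" for k
    using cos_multiple_recurrence[of k "pi / m"] by (simp only: C_def pq[symmetric] right_diff_distrib)
  \<comment> \<open>\<open>C k * q ^ k\<close> is an integer congruent to \<open>p ^ k\<close> modulo \<open>q\<close>; for \<open>k = m\<close> it is \<open>- 2 q ^ m\<close>, so \<open>q\<close> divides \<open>p ^ m\<close>.\<close>
  have "\<exists>v w. C k * q ^ k = real_of_int v \<and> C (Suc k) * q ^ Suc k = real_of_int w
      \<and> q dvd w - p ^ Suc k" for k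
  proof (induction k)
    case 0
    have "C 0 * q ^ 0 = real_of_int 2" "C (Suc 0) * q ^ Suc 0 = real_of_int p"
      using q by (simp_all add: C_def pq)
    then show ?case by (metis diff_self dvd_0_right power_Suc0_right)
  next
    case (Suc k)
    then obtain v w where v: "C k * q ^ k = real_of_int v"
      and w: "C (Suc k) * q ^ Suc k = real_of_int w" and dvd: "q dvd w - p ^ Suc k"
      by blast
    have "C (Suc (Suc k)) * q ^ Suc (Suc k) = p * (C (Suc k) * q ^ Suc k) - q ^ 2 * (C k * q ^ k)"
      using q by (simp add: C_rec power2_eq_square field_simps)
    also have "\<dots> = real_of_int (p * w - q ^ 2 * v)"
      by (simp only: v w) simp
    finally have "C (Suc (Suc k)) * q ^ Suc (Suc k) = real_of_int (p * w - q ^ 2 * v)" .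
    moreover have "p * w - q ^ 2 * v - p ^ Suc (Suc k) = p * (w - p ^ Suc k) - q * (q * v)"
      by (simp add: algebra_simps power2_eq_square)
    then have "q dvd p * w - q ^ 2 * v - p ^ Suc (Suc k)"
      using dvd by simp
    ultimately show ?case using w by blast
  qed
  from this[of "m - 1"] obtain w :: int
    where w: "C m * q ^ m = real_of_int w" and dvd: "q dvd w - p ^ m"
    using m by (metis Suc_pred')
  have "C m = - 2" using m by (simp add: C_def)
  then have "real_of_int w = real_of_int (- 2 * q ^ m)" using w by simp
  then have "w = - 2 * q ^ m" by (simp only: of_int_eq_iff)
  then have "q dvd w" using m by simp
  then have "q dvd p ^ m" using dvd by (metis dvd_diff_right_iff dvd_minus_iff)
  then have "is_unit q"
    using q(2) by (metis coprime_common_divisor coprime_power_left_iff dvd_refl)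
  then have x_int: "2 * cos (pi / m) = p" using pq q(1) by simp
  show ?thesis
  proof (rule ccontr)
    assume "\<not> m \<le> 3"
    then have m4: "m \<ge> 4" by simp
    have "cos (pi / 3) < cos (pi / m)"
      using m4 by (intro cos_monotone_0_pi) (auto simp: field_simps)
    moreover have "cos (pi / m) < cos 0"
      using m4 by (intro cos_monotone_0_pi) (auto simp: field_simps)
    ultimately have "1 < real_of_int p" "real_of_int p < 2"
      using x_int by (simp_all add: cos_60)
    then have "1 < p" "p < 2" by simp_all
    then show False by simp
  qed
qed

section \<open>Arithmetic of the phase conditions\<close>

text \<open>The indices 1 and 2 always satisfy the divisibility proviso. The cases B, C and A say
  that index 3, index 4 or neither is blocked. Each picks two cosines whose difference, multiplied
  by \<open>x\<close>, expands into cosines at available indices.\<close>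

lemma phase_condition_solutions:
  fixes m a :: nat and \<tau> :: real
  assumes a: "0 < a" "a < 2 * m" "a \<noteq> m" and \<tau>: "\<tau> > 0"
    and phase: "\<And>k. \<not> 2 * m dvd k * a \<Longrightarrow> \<exists>q :: int.
      2 * \<tau> * (cos (pi / m) - cos (real k * pi / m)) = q * pi \<and> (even q \<longleftrightarrow> odd k)"
  shows "m = 2 \<and> a \<in> {1, 3} \<or> m = 3 \<and> a \<in> {2, 4} \<or> m = 4 \<and> a \<in> {2, 6}"
proof -
  define x where "x = 2 * cos (pi / m)"
  define c where "c k = cos (real k * pi / m)" for k :: nat
  have m2: "m \<ge> 2" using a by auto
  have c1: "c 1 = cos (pi / m)" by (simp add: c_def)
  have rec: "x * c (Suc k) = c k + c (Suc (Suc k))" for k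
    using cos_multiple_recurrence[of k "pi / m"] by (simp add: x_def c_def)
  have rec2: "x * c 2 = c 1 + c 3" and rec3: "x * c 3 = c 2 + c 4" and rec4: "x * c 4 = c 3 + c 5"
    and rec6: "x * c 6 = c 5 + c 7"
    using rec[of 1] rec[of 2] rec[of 3] rec[of 5] by (simp_all add: eval_nat_numeral)
  \<comment> \<open>Dividing the two multiples of \<open>pi\<close> exhibits \<open>x\<close> as a
    quotient of integers.\<close>
  have rational: "m \<le> 3" if "x * (\<tau> * u) = of_int i * pi" "\<tau> * u = of_int j * pi" "j \<noteq> 0" for i j :: int and u
  proof -
    have "(x * of_int j) * pi = of_int i * pi" using that by (simp add: mult.assoc)
    then have "x = of_int i / of_int j" using that(3) by (simp add: field_simps)
    then show ?thesis using two_cos_rational[of m] m2 unfolding x_def by auto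
  qed
  have ph: "\<exists>q :: int. 2 * \<tau> * (c 1 - c k) = q * pi \<and> (even q \<longleftrightarrow> odd k)" if "\<not> 2 * m dvd k * a" for k
    using phase[OF that] unfolding c1 by (simp add: c_def)
  have nd1: "\<not> 2 * m dvd a" using a by (auto dest: dvd_imp_le)
  have nd2: "\<not> 2 * m dvd 2 * a"
  proof
    assume "2 * m dvd 2 * a"
    then obtain t where t: "a = m * t" by auto
    then have "t < 2" "t > 0" using a by (auto simp: mult.commute)
    then have "t = 1" by simp
    then show False using t a by simp
  qed
  have sin0: "m dvd k" if z: "sin (real k * pi / m) = 0" for k
  proof -
    obtain i :: int where "real k * pi / m = of_int i * pi"
      using z sin_zero_iff_int2 by blast
    then have "real k * pi = (real m * of_int i) * pi" using m2 by (simp add: field_simps)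
    then have "real k = real m * of_int i" by simp
    then have "int k = int m * i" by (metis of_int_eq_iff of_int_mult of_int_of_nat_eq)
    then show ?thesis by (metis dvd_triv_left int_dvd_int_iff)
  qed
  \<comment> \<open>The difference of the cosines is a product of two sines at the half sum and half
    difference of the angles, which are \<open>i * pi / m\<close> and \<open>j * pi / m\<close>.
    This will keep denominators from vanishing.\<close>
  have c_eq: "m dvd i \<or> m dvd j" if "c k = c l" "k + l = 2 * i" "l = k + 2 * j" for i j k l
  proof -
    have "c k - c l = 2 * sin ((real k * pi / m + real l * pi / m) / 2) * sin ((real l * pi / m - real k * pi / m) / 2)"
      unfolding c_def by (rule cos_diff_cos)
    also have "(real k * pi / m + real l * pi / m) / 2 = real (k + l) * pi / m / 2"
      by (simp add: add_divide_distrib distrib_left mult.commute)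
    also have "\<dots> = real i * pi / m" unfolding that(2) by simp
    also have "(real l * pi / m - real k * pi / m) / 2 = real j * pi / m"
      unfolding that(3) by (simp add: add_divide_distrib distrib_right)
    finally have "sin (real i * pi / m) = 0 \<or> sin (real j * pi / m) = 0" using that(1) by simp
    then show ?thesis using sin0 by blast
  qed
  consider (B) "2 * m dvd 3 * a" | (C) "2 * m dvd 4 * a" | (A) "\<not> 2 * m dvd 3 * a" "\<not> 2 * m dvd 4 * a"
    by blast
  then show ?thesis
  proof cases
    case B
    show ?thesis
    proof (cases "m = 3")
      case True
      then have "2 dvd a" using B by presburger
      then show ?thesis using a True by auto
    next
      case False
      \<comment> \<open>Since \<open>2 * m\<close> divides \<open>3 * a\<close>, dividing
        \<open>4 * a\<close> or \<open>5 * a\<close> too would make it divide \<open>a\<close> or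
        \<open>2 * a\<close>.\<close>
      have "\<not> 2 * m dvd 4 * a" using nd1 B dvd_diff_nat[of "2 * m" "4 * a" "3 * a"] by auto
      moreover have "\<not> 2 * m dvd 5 * a" using nd2 B dvd_diff_nat[of "2 * m" "5 * a" "3 * a"] by auto
      ultimately obtain q2 q4 q5 :: int where q: "2 * \<tau> * (c 1 - c 2) = q2 * pi"
          "2 * \<tau> * (c 1 - c 4) = q4 * pi" "2 * \<tau> * (c 1 - c 5) = q5 * pi"
        using nd2 ph[of 2] ph[of 4] ph[of 5] by blast
      have "c 2 \<noteq> c 4"
      proof
        assume "c 2 = c 4"
        then have "m dvd 3 \<or> m dvd 1" by (rule c_eq) simp_all
        then have "m dvd 3" by auto
        moreover from this have "m = 2" using dvd_imp_le[of m 3] False m2 by simp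
        ultimately show False by simp
      qed
      then have "\<tau> * (2 * (c 2 - c 4)) \<noteq> 0" using \<tau> by simp
      moreover have diff: "\<tau> * (2 * (c 2 - c 4)) = of_int (q4 - q2) * pi"
        using q by (simp add: algebra_simps)
      ultimately have "q4 - q2 \<noteq> 0" by (metis mult_zero_left of_int_0)
      \<comment> \<open>In \<open>x * c 2 - x * c 4\<close> the blocked \<open>c 3\<close> cancels,
        leaving \<open>c 1 - c 5\<close>.\<close>
      have "x * (\<tau> * (2 * (c 2 - c 4))) = 2 * \<tau> * (x * c 2 - x * c 4)"
        by (simp add: algebra_simps)
      then have "x * (\<tau> * (2 * (c 2 - c 4))) = of_int q5 * pi"
        using q unfolding rec2 rec4 by (simp add: algebra_simps)
      from rational[OF this diff \<open>q4 - q2 \<noteq> 0\<close>] have "m \<le> 3" .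
      then have "m = 2" using m2 False by simp
      then have "4 dvd a" using B by presburger
      then show ?thesis using a \<open>m = 2\<close> by auto
    qed
  next
    case C
    show ?thesis
    proof (cases "m dvd 4")
      case True
      then have "m \<le> 4" "m \<noteq> 3" by (auto dest: dvd_imp_le)
      then consider "m = 2" | "m = 4" using m2 by linarith
      then show ?thesis
      proof cases
        case 2
        then have "2 dvd a" using C by presburger
        then show ?thesis using 2 a by auto
      qed (use a in auto)
    next
      case False
      have nd3: "\<not> 2 * m dvd 3 * a" using nd1 C dvd_diff_nat[of "2 * m" "4 * a" "3 * a"] by auto
      have "\<not> 2 * m dvd 5 * a" using nd1 C dvd_diff_nat[of "2 * m" "5 * a" "4 * a"] by auto
      moreover have "\<not> 2 * m dvd 6 * a" using nd2 C dvd_diff_nat[of "2 * m" "6 * a" "4 * a"] by auto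
      moreover have "\<not> 2 * m dvd 7 * a" using nd3 C dvd_diff_nat[of "2 * m" "7 * a" "4 * a"] by auto
      ultimately obtain q2 q3 q5 q6 q7 :: int where q: "2 * \<tau> * (c 1 - c 2) = q2 * pi"
          "2 * \<tau> * (c 1 - c 3) = q3 * pi" "2 * \<tau> * (c 1 - c 5) = q5 * pi"
          "2 * \<tau> * (c 1 - c 6) = q6 * pi" "2 * \<tau> * (c 1 - c 7) = q7 * pi"
        using nd2 nd3 ph[of 2] ph[of 3] ph[of 5] ph[of 6] ph[of 7] by blast
      have "c 2 \<noteq> c 6"
      proof
        assume "c 2 = c 6"
        then have "m dvd 4 \<or> m dvd 2" by (rule c_eq) simp_all
        then show False using False dvd_trans[of m 2 4] by auto
      qed
      then have "\<tau> * (2 * (c 2 - c 6)) \<noteq> 0" using \<tau> by simp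
      moreover have diff: "\<tau> * (2 * (c 2 - c 6)) = of_int (q6 - q2) * pi"
        using q by (simp add: algebra_simps)
      ultimately have "q6 - q2 \<noteq> 0" by (metis mult_zero_left of_int_0)
      \<comment> \<open>Here \<open>x * c 2 - x * c 6\<close> is
        \<open>c 1 + c 3 - c 5 - c 7\<close>, which bypasses the blocked \<open>c 4\<close>.\<close>
      have "x * (\<tau> * (2 * (c 2 - c 6))) = 2 * \<tau> * (x * c 2 - x * c 6)"
        by (simp add: algebra_simps)
      then have "x * (\<tau> * (2 * (c 2 - c 6))) = of_int (q5 + q7 - q3) * pi"
        using q unfolding rec2 rec6 by (simp add: algebra_simps)
      from rational[OF this diff \<open>q6 - q2 \<noteq> 0\<close>] have "m \<le> 3" .
      moreover have "m \<noteq> 2" using False by auto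
      ultimately have "m = 3" using m2 by simp
      then have "3 dvd a" using C by presburger
      then have False using a \<open>m = 3\<close> by presburger
      then show ?thesis ..
    qed
  next
    case A
    obtain q2 q3 q4 :: int where q: "2 * \<tau> * (c 1 - c 2) = q2 * pi"
        "2 * \<tau> * (c 1 - c 3) = q3 * pi" "2 * \<tau> * (c 1 - c 4) = q4 * pi" and par: "odd q2" "even q3"
      using nd2 A ph[of 2] ph[of 3] ph[of 4] by auto
    \<comment> \<open>Opposite parities make the denominator nonzero.\<close>
    have nz: "q3 - q2 \<noteq> 0" using par by auto
    have diff: "\<tau> * (2 * (c 2 - c 3)) = of_int (q3 - q2) * pi"
      using q by (simp add: algebra_simps)
    have "x * (\<tau> * (2 * (c 2 - c 3))) = 2 * \<tau> * (x * c 2 - x * c 3)"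
      by (simp add: algebra_simps)
    then have "x * (\<tau> * (2 * (c 2 - c 3))) = of_int (q2 + q4 - q3) * pi"
      using q unfolding rec2 rec3 by (simp add: algebra_simps)
    from rational[OF this diff nz] have "m \<le> 3" .
    then consider "m = 2" | "m = 3" using m2 by linarith
    then show ?thesis
    proof cases
      case 2
      have c123: "c 1 = 1 / 2" "c 2 = - 1 / 2" "c 3 = - 1"
        using 2 by (simp_all add: c_def cos_60 cos_120)
      have "2 * \<tau> = q2 * pi" using q(1) unfolding c123 by simp
      moreover have "3 * \<tau> = q3 * pi" using q(2) unfolding c123 by simp
      \<comment> \<open>Eliminating \<open>\<tau>\<close> leaves \<open>3 * q2 = 2 * q3\<close>,
        which contradicts the oddness of \<open>q2\<close>.\<close>
      ultimately have "(3 * real_of_int q2) * pi = (2 * real_of_int q3) * pi" by linarith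
      then have "3 * real_of_int q2 = 2 * real_of_int q3" by simp
      then have "3 * q2 = 2 * q3" by linarith
      then show ?thesis using par by presburger
    qed (use a in auto)
  qed
qed

section \<open>Sine eigenvectors of the path\<close>

text \<open>The sine vanishes at the fictitious vertices 0 and \<open>n + 1\<close>, so both end
  vertices obey the same two-neighbour rule as the others; the addition formulas then give the
  eigenvalue.\<close>

lemma path_eigenvector:
  fixes n k :: nat
  defines "\<theta> \<equiv> real k * pi / real (n + 1)"
  shows "path_adj_mat n *\<^sub>v vec n (\<lambda>i. sin (real (i + 1) * \<theta>)) =
    (2 * cos \<theta>) \<cdot>\<^sub>v vec n (\<lambda>i. sin (real (i + 1) * \<theta>))"
proof (rule eq_vecI)
  let ?u = "vec n (\<lambda>i. sin (real (i + 1) * \<theta>))"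
  fix i assume "i < dim_vec ((2 * cos \<theta>) \<cdot>\<^sub>v ?u)"
  then have i: "i < n" by simp
  have "real (n + 1) * \<theta> = real k * pi"
    by (simp add: \<theta>_def)
  then have "sin (real (n + 1) * \<theta>) = 0" by (simp only: sin_npi)
  then have right: "(if i + 1 < n then ?u $ (i + 1) else 0) = sin (real (i + 1) * \<theta> + \<theta>)"
    using i by (cases "i + 1 = n") (auto simp: algebra_simps)
  have left: "(if 0 < i then ?u $ (i - 1) else 0) = sin (real (i + 1) * \<theta> - \<theta>)"
    using i by (auto simp: algebra_simps)
  show "(path_adj_mat n *\<^sub>v ?u) $ i = ((2 * cos \<theta>) \<cdot>\<^sub>v ?u) $ i"
    using i by (subst path_adj_mat_mult_vec) (simp_all only: left right, simp_all add: sin_add sin_diff)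
qed (simp add: path_adj_mat_def)

section \<open>Perfect state transfer on paths\<close>

lemma sin_eq_imp_supplementary:
  fixes x y :: real
  assumes "0 < x" "x < pi" "0 < y" "y < pi" "sin x = sin y" "x \<noteq> y"
  shows "x + y = pi"
proof -
  have "sin ((x - y) / 2) * cos ((x + y) / 2) = 0"
    using sin_diff_sin[of x y] assms by simp
  moreover have "sin ((x - y) / 2) \<noteq> 0"
    using sin_eq_0_pi[of "(x - y) / 2"] assms by auto
  ultimately have "cos ((x + y) / 2) = cos (pi / 2)" by simp
  then show ?thesis
    using cos_inj_pi[of "(x + y) / 2" "pi / 2"] assms by simp
qed

lemma path_transfer_time_phases:
  assumes ab: "a \<in> {1..n}" "b \<in> {1..n}" "a \<noteq> b"
    and tr: "transfer_time (path_adj_mat n ^\<^sub>m 2) a b \<tau>"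
  obtains m :: nat where "n + 1 = 2 * m" "a + b = 2 * m"
    "\<And>k. \<not> 2 * m dvd k * a \<Longrightarrow> \<exists>q :: int.
      2 * \<tau> * (cos (pi / m) - cos (real k * pi / m)) = q * pi \<and> (even q \<longleftrightarrow> odd k)"
proof -
  define \<theta> where "\<theta> k = real k * pi / real (n + 1)" for k :: nat
  define e where "e k = cis (- \<tau> * (2 * cos (\<theta> k))\<^sup>2)" for k
  have e_nz: "e k \<noteq> 0" for k by (simp add: e_def)
  obtain \<gamma> where \<gamma>: "cmod \<gamma> = 1" and eig: "\<And>u \<rho>. u \<in> carrier_vec n \<Longrightarrow>
      path_adj_mat n ^\<^sub>m 2 *\<^sub>v u = \<rho> \<cdot>\<^sub>v u \<Longrightarrow>
      cis (- \<tau> * \<rho>) * complex_of_real (u $ (a - 1)) = \<gamma> * complex_of_real (u $ (b - 1))"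
    using transfer_time_eigenvectors[OF path_adj_mat_sq_carrier path_adj_mat_sq_symmetric ab(1,2) tr]
    by metis
  have key: "e k * complex_of_real (sin (a * \<theta> k)) = \<gamma> * complex_of_real (sin (b * \<theta> k))" for k
  proof -
    let ?u = "vec n (\<lambda>i. sin (real (i + 1) * \<theta> k))"
    have A: "path_adj_mat n *\<^sub>v ?u = (2 * cos (\<theta> k)) \<cdot>\<^sub>v ?u"
      unfolding \<theta>_def by (rule path_eigenvector)
    have "path_adj_mat n ^\<^sub>m 2 *\<^sub>v ?u = (2 * cos (\<theta> k))\<^sup>2 \<cdot>\<^sub>v ?u"
      by (rule pow_mat_eigenvector[OF path_adj_mat_carrier _ A]) simp
    from eig[OF _ this] have "e k * complex_of_real (?u $ (a - 1)) = \<gamma> * complex_of_real (?u $ (b - 1))"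
      unfolding e_def by simp
    moreover have "?u $ (a - 1) = sin (a * \<theta> k)" "?u $ (b - 1) = sin (b * \<theta> k)"
      using ab by auto
    ultimately show ?thesis by simp
  qed
  have angle: "0 < j * \<theta> 1" "j * \<theta> 1 < pi" if "j \<in> {1..n}" for j :: nat
  proof -
    have "real j * pi < (real n + 1) * pi" using that by (intro mult_strict_right_mono) auto
    then show "0 < j * \<theta> 1" "j * \<theta> 1 < pi" using that by (auto simp: \<theta>_def field_simps)
  qed
  have pos: "sin (j * \<theta> 1) > 0" if "j \<in> {1..n}" for j :: nat
    using angle[OF that] by (rule sin_gt_zero)
  \<comment> \<open>For \<open>k = 1\<close> every entry is positive, so taking moduli removes the
    phases.\<close>
  have "sin (a * \<theta> 1) = sin (b * \<theta> 1)"
    using arg_cong[OF key[of 1], of cmod] pos[OF ab(1)] pos[OF ab(2)] \<gamma>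
    by (simp add: norm_mult e_def)
  moreover have "\<theta> 1 \<noteq> 0" by (simp add: \<theta>_def)
  ultimately have "a * \<theta> 1 + b * \<theta> 1 = pi"
    using angle ab by (intro sin_eq_imp_supplementary) auto
  moreover have "real (n + 1) * \<theta> 1 = pi" by (simp add: \<theta>_def)
  moreover have "real (a + b) * (real (n + 1) * \<theta> 1) = real (n + 1) * (a * \<theta> 1 + b * \<theta> 1)"
    by (simp add: algebra_simps)
  ultimately have "real (a + b) * pi = real (n + 1) * pi" by (simp only:)
  then have sum: "a + b = n + 1"
    by (simp only: mult_cancel_right of_nat_eq_iff pi_neq_zero simp_thms)
  have sin_b: "sin (b * \<theta> k) = - ((- 1) ^ k) * sin (a * \<theta> k)" for k
  proof -
    have "a * \<theta> k + b * \<theta> k = real (a + b) * \<theta> k" by (simp add: algebra_simps)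
    also have "\<dots> = real k * pi" unfolding sum by (simp add: \<theta>_def)
    finally have "b * \<theta> k = real k * pi - a * \<theta> k" by simp
    then show ?thesis by (simp add: sin_diff)
  qed
  have e_eq: "e k = - ((- 1) ^ k) * \<gamma>" if "sin (a * \<theta> k) \<noteq> 0" for k
  proof -
    have "e k * complex_of_real (sin (a * \<theta> k)) = (- ((- 1) ^ k) * \<gamma>) * complex_of_real (sin (a * \<theta> k))"
      using key[of k] unfolding sin_b by (simp add: mult_ac)
    then show ?thesis using that by (simp only: mult_cancel_right of_real_eq_0_iff simp_thms)
  qed
  have e1: "e 1 = \<gamma>" using e_eq[of 1] pos[OF ab(1)] by simp
  have sin_nz: "sin (a * \<theta> k) \<noteq> 0" if "\<not> n + 1 dvd k * a" for k
  proof
    assume "sin (a * \<theta> k) = 0"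
    then obtain i :: int where "a * \<theta> k = of_int i * pi"
      using sin_zero_iff_int2 by blast
    then have "real (k * a) * pi = (real (n + 1) * of_int i) * pi"
      by (simp add: \<theta>_def field_simps)
    then have "real (k * a) = real (n + 1) * of_int i" by simp
    then have "int (k * a) = int (n + 1) * i"
      by (metis of_int_eq_iff of_int_mult of_int_of_nat_eq)
    then show False using that by (metis dvd_triv_left int_dvd_int_iff)
  qed
  \<comment> \<open>The angles for \<open>k = n\<close> and \<open>k = 1\<close> add up to
    \<open>pi\<close>, so the squared cosines agree. For even \<open>n\<close> the two phases would
    have to be opposite.\<close>
  have "odd n"
  proof
    assume "even n"
    have n_angle: "\<theta> n = pi - \<theta> 1" by (simp add: \<theta>_def field_simps)
    then have "e n = e 1" by (simp add: e_def)
    have "a * \<theta> n = real a * pi - a * \<theta> 1" by (simp add: n_angle algebra_simps)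
    then have "sin (a * \<theta> n) \<noteq> 0" using pos[OF ab(1)] by (simp add: sin_diff)
    then have "\<gamma> = - \<gamma>" using e_eq[of n] \<open>e n = e 1\<close> e1 \<open>even n\<close> by simp
    then show False using \<gamma> by auto
  qed
  then obtain m where m: "n + 1 = 2 * m" by (metis even_plus_one_iff dvd_def)
  have m0: "m > 0" using m by (cases m) auto
  have sq: "(2 * cos (\<theta> k))\<^sup>2 = 2 + 2 * cos (real k * pi / m)" for k
  proof -
    have "real k * pi / m = 2 * \<theta> k" using m0 unfolding \<theta>_def m by simp
    then show ?thesis by (simp add: cos_double_cos power2_eq_square)
  qed
  show ?thesis
  proof (rule that[OF m])
    show "a + b = 2 * m" using sum m by simp
    fix k assume k: "\<not> 2 * m dvd k * a"
    let ?x = "2 * \<tau> * (cos (pi / m) - cos (real k * pi / m))"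
    have "?x = \<tau> * (2 * cos (\<theta> 1))\<^sup>2 + - \<tau> * (2 * cos (\<theta> k))\<^sup>2"
      unfolding sq by (simp add: algebra_simps)
    then have "cis ?x * e 1 = e k"
      by (simp add: e_def cis_mult)
    then have "cis ?x * \<gamma> = - ((- 1) ^ k) * \<gamma>"
      using e_eq[OF sin_nz] k m e1 by simp
    then have "cis ?x = - ((- 1) ^ k)"
      using e1 e_nz[of 1] by (simp only: mult_cancel_right simp_thms)
    \<comment> \<open>The sign \<open>- ((- 1) ^ k)\<close> is absorbed as \<open>k + 1\<close> half
      turns; this fixes the parity of the multiple of \<open>pi\<close>.\<close>
    then have "cis (?x + real (k + 1) * pi) = 1"
      by (simp only: cis_mult[symmetric] DeMoivre[symmetric] cis_pi) (simp flip: power_mult_distrib)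
    then have "cos (?x + real (k + 1) * pi) = 1"
      by (metis cis.simps(1) one_complex.simps(1))
    then obtain j :: int where "?x + real (k + 1) * pi = of_int j * 2 * pi"
      unfolding cos_one_2pi_int by blast
    then have "?x = of_int (2 * j - int (k + 1)) * pi"
      by (simp add: algebra_simps)
    then show "\<exists>q :: int. ?x = q * pi \<and> (even q \<longleftrightarrow> odd k)"
      by (intro exI[of _ "2 * j - int (k + 1)"]) auto
  qed
qed

lemma transfer_time_lower_bound:
  fixes D :: real and q :: int
  assumes "\<tau> > 0" "D > 0" "\<tau> * D = of_int q * pi"
  shows "pi / D \<le> \<tau>"
proof -
  have "of_int q * pi > 0" using assms by (metis mult_pos_pos)
  then have "q \<ge> 1" by (simp add: zero_less_mult_iff)
  then have "1 * pi \<le> of_int q * pi" by (intro mult_right_mono) auto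
  then show ?thesis using assms by (simp add: field_simps)
qed

section \<open>Transfer in the three examples\<close>

text \<open>Each of the two unit vectors is half the sum or half the difference of the two given
  vectors, so opposite phases on these swap \<open>a\<close> and \<open>b\<close> up to
  \<open>g\<close>.\<close>

lemma transfer_time_sum_diff:
  fixes K :: "real mat" and n a b :: nat and \<tau> :: real
  defines "E \<equiv> mat_exp ((- \<i> * complex_of_real \<tau>) \<cdot>\<^sub>m map_mat complex_of_real K)"
  assumes K: "K \<in> carrier_mat n n" and ab: "a \<in> {1..n}" "b \<in> {1..n}" and "\<tau> > 0"
    and g: "cmod g = 1"
    and plus: "E *\<^sub>v map_vec complex_of_real (unit_vec n (a - 1) + unit_vec n (b - 1))
      = g \<cdot>\<^sub>v map_vec complex_of_real (unit_vec n (a - 1) + unit_vec n (b - 1))"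
    and minus: "E *\<^sub>v map_vec complex_of_real (unit_vec n (a - 1) - unit_vec n (b - 1))
      = (- g) \<cdot>\<^sub>v map_vec complex_of_real (unit_vec n (a - 1) - unit_vec n (b - 1))"
  shows "transfer_time K a b \<tau> \<and> transfer_time K b a \<tau>"
proof -
  let ?a = "unit_vec n (a - 1) :: complex vec" and ?b = "unit_vec n (b - 1) :: complex vec"
  have E: "E \<in> carrier_mat n n"
    unfolding E_def using K by (intro mat_exp_carrier) simp
  have "map_vec complex_of_real (unit_vec n (a - 1) + unit_vec n (b - 1)) = ?a + ?b"
    by (rule eq_vecI) (auto simp: unit_vec_def)
  then have "E *\<^sub>v (?a + ?b) = g \<cdot>\<^sub>v (?a + ?b)"
    using plus by simp
  then have p: "E *\<^sub>v ?a + E *\<^sub>v ?b = g \<cdot>\<^sub>v (?a + ?b)"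
    using E by (simp add: mult_add_distrib_mat_vec[of _ n n])
  have "map_vec complex_of_real (unit_vec n (a - 1) - unit_vec n (b - 1)) = ?a - ?b"
    by (rule eq_vecI) (auto simp: unit_vec_def)
  then have "E *\<^sub>v (?a - ?b) = (- g) \<cdot>\<^sub>v (?a - ?b)"
    using minus by simp
  then have q: "E *\<^sub>v ?a - E *\<^sub>v ?b = (- g) \<cdot>\<^sub>v (?a - ?b)"
    using E by (simp add: mult_minus_distrib_mat_vec[of _ n n])
  have "(E *\<^sub>v ?a) $ i = g * ?b $ i \<and> (E *\<^sub>v ?b) $ i = g * ?a $ i" if i: "i < n" for i
  proof -
    have "(E *\<^sub>v ?a) $ i + (E *\<^sub>v ?b) $ i = g * (?a $ i + ?b $ i)"
      using arg_cong[OF p, of "\<lambda>w. w $ i"] i E by simp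
    moreover have "(E *\<^sub>v ?a) $ i - (E *\<^sub>v ?b) $ i = - g * (?a $ i - ?b $ i)"
      using arg_cong[OF q, of "\<lambda>w. w $ i"] i E by simp
    moreover have "x = g * t \<and> y = g * s" if "x + y = g * (s + t)" "x - y = - g * (s - t)"
      for x y s t :: complex
    proof -
      have "2 * x = (x + y) + (x - y)" "2 * y = (x + y) - (x - y)" by simp_all
      then have "2 * x = 2 * (g * t)" "2 * y = 2 * (g * s)"
        unfolding that by (simp_all add: algebra_simps)
      then show ?thesis by simp
    qed
    ultimately show ?thesis by blast
  qed
  then have "E *\<^sub>v ?a = g \<cdot>\<^sub>v ?b" "E *\<^sub>v ?b = g \<cdot>\<^sub>v ?a"
    using E by (auto intro!: eq_vecI)
  then show ?thesis
    using K g \<open>\<tau> > 0\<close> unfolding transfer_time_def vertex_vec_def E_def by auto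
qed

text \<open>Sum and difference have eigenvalues 2 and 0, hence phases -1 and 1 at time
  \<open>pi / 2\<close>.\<close>

lemma transfer_time_P3:
  "transfer_time (path_adj_mat 3 ^\<^sub>m 2) 1 3 (pi / 2) \<and> transfer_time (path_adj_mat 3 ^\<^sub>m 2) 3 1 (pi / 2)"
proof -
  let ?K = "path_adj_mat 3 ^\<^sub>m 2"
  let ?p = "unit_vec 3 (1 - 1) + unit_vec 3 (3 - 1) :: real vec"
  let ?q = "unit_vec 3 (1 - 1) - unit_vec 3 (3 - 1) :: real vec"
  note Av = path_adj_mat_mult_vec[OF mult_mat_vec_carrier[OF path_adj_mat_carrier]] path_adj_mat_mult_vec
  have p: "?K *\<^sub>v ?p = 2 \<cdot>\<^sub>v ?p"
    by (rule path_adj_mat_sq_eigenvector) (auto simp: Av less_Suc_eq eval_nat_numeral)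
  have q: "?K *\<^sub>v ?q = 0 \<cdot>\<^sub>v ?q"
    by (rule path_adj_mat_sq_eigenvector) (auto simp: Av less_Suc_eq eval_nat_numeral)
  have "cis (- pi) = - 1" by (simp add: complex_eq_iff)
  then show ?thesis
    using transfer_eigenvector[OF path_adj_mat_sq_carrier _ p, of "pi / 2"]
      transfer_eigenvector[OF path_adj_mat_sq_carrier _ q, of "pi / 2"]
    by (intro transfer_time_sum_diff[where n = 3 and g = "- 1"])
      (simp_all add: path_adj_mat_sq_carrier)
qed

text \<open>Sum and difference have eigenvalues 3 and 1, hence phases \<open>\<i>\<close> and
  \<open>- \<i>\<close> at time \<open>pi / 2\<close>.\<close>

lemma transfer_time_P5:
  "transfer_time (path_adj_mat 5 ^\<^sub>m 2) 2 4 (pi / 2) \<and> transfer_time (path_adj_mat 5 ^\<^sub>m 2) 4 2 (pi / 2)"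
proof -
  let ?K = "path_adj_mat 5 ^\<^sub>m 2"
  let ?p = "unit_vec 5 (2 - 1) + unit_vec 5 (4 - 1) :: real vec"
  let ?q = "unit_vec 5 (2 - 1) - unit_vec 5 (4 - 1) :: real vec"
  note Av = path_adj_mat_mult_vec[OF mult_mat_vec_carrier[OF path_adj_mat_carrier]] path_adj_mat_mult_vec
  have p: "?K *\<^sub>v ?p = 3 \<cdot>\<^sub>v ?p"
    by (rule path_adj_mat_sq_eigenvector) (auto simp: Av less_Suc_eq eval_nat_numeral)
  have q: "?K *\<^sub>v ?q = 1 \<cdot>\<^sub>v ?q"
    by (rule path_adj_mat_sq_eigenvector) (auto simp: Av less_Suc_eq eval_nat_numeral)
  have "- (pi / 2) * 3 = pi / 2 - 2 * pi" by simp
  then have "cis (- (pi / 2) * 3) = \<i>" by (simp only: cis_divide[symmetric] cis_2pi) simp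
  then show ?thesis
    using transfer_eigenvector[OF path_adj_mat_sq_carrier _ p, of "pi / 2"]
      transfer_eigenvector[OF path_adj_mat_sq_carrier _ q, of "pi / 2"]
    by (intro transfer_time_sum_diff[where n = 5 and g = "\<i>"])
      (simp_all add: path_adj_mat_sq_carrier)
qed

lemma transfer_time_P7:
  "transfer_time (path_adj_mat 7 ^\<^sub>m 2) 2 6 (pi / sqrt 2) \<and> transfer_time (path_adj_mat 7 ^\<^sub>m 2) 6 2 (pi / sqrt 2)"
proof -
  let ?K = "path_adj_mat 7 ^\<^sub>m 2"
  let ?p = "unit_vec 7 (2 - 1) + unit_vec 7 (6 - 1) :: real vec"
  let ?q = "unit_vec 7 (2 - 1) - unit_vec 7 (6 - 1) :: real vec"
  \<comment> \<open>The eigenvectors \<open>r (sqrt 2)\<close> and \<open>r (- sqrt 2)\<close> have sum \<open>2 ?p\<close> and acquire the same phase at time \<open>\<pi> / sqrt 2\<close>.\<close>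
  define r where "r s = unit_vec 7 (2 - 1) + s \<cdot>\<^sub>v unit_vec 7 (4 - 1) + unit_vec 7 (6 - 1)" for s :: real
  \<comment> \<open>The difference \<open>?q\<close> has eigenvalue 2 and so acquires the phase
    \<open>- g\<close>. The eigenvalues \<open>2 + sqrt 2\<close> and \<open>2 - sqrt 2\<close>
    shift the angle by a half turn, which gives \<open>g\<close>.\<close>
  define g where "g = - cis (- (pi / sqrt 2) * 2)"
  define E where "E = mat_exp ((- \<i> * complex_of_real (pi / sqrt 2)) \<cdot>\<^sub>m map_mat complex_of_real ?K)"
  note Av = path_adj_mat_mult_vec[OF mult_mat_vec_carrier[OF path_adj_mat_carrier]] path_adj_mat_mult_vec
  have r_carrier: "r s \<in> carrier_vec 7" for s by (simp add: r_def)
  \<comment> \<open>The condition on \<open>s\<close> comes from vertex 4, where the entries are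
    \<open>2 + 2 * s\<close> and \<open>(2 + s) * s\<close>.\<close>
  have r: "?K *\<^sub>v r s = (2 + s) \<cdot>\<^sub>v r s" if "s * s = 2" for s
    by (rule path_adj_mat_sq_eigenvector[OF r_carrier])
      (auto simp: r_def Av less_Suc_eq eval_nat_numeral algebra_simps that[simplified eval_nat_numeral])
  have q: "?K *\<^sub>v ?q = 2 \<cdot>\<^sub>v ?q"
    by (rule path_adj_mat_sq_eigenvector) (auto simp: Av less_Suc_eq eval_nat_numeral)
  have "- (pi / sqrt 2) * (2 + sqrt 2) = - (pi / sqrt 2) * 2 - pi"
    "- (pi / sqrt 2) * (2 + - sqrt 2) = - (pi / sqrt 2) * 2 + pi"
    by (simp_all add: field_simps)
  then have "cis (- (pi / sqrt 2) * (2 + sqrt 2)) = g" "cis (- (pi / sqrt 2) * (2 + - sqrt 2)) = g"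
    unfolding g_def by (simp_all only: cis_divide[symmetric] cis_mult[symmetric] cis_pi) simp_all
  then have Er: "E *\<^sub>v map_vec complex_of_real (r (sqrt 2)) = g \<cdot>\<^sub>v map_vec complex_of_real (r (sqrt 2))"
    "E *\<^sub>v map_vec complex_of_real (r (- sqrt 2)) = g \<cdot>\<^sub>v map_vec complex_of_real (r (- sqrt 2))"
    using transfer_eigenvector[OF path_adj_mat_sq_carrier r_carrier r, of "sqrt 2" "pi / sqrt 2"]
      transfer_eigenvector[OF path_adj_mat_sq_carrier r_carrier r, of "- sqrt 2" "pi / sqrt 2"]
    by (simp_all add: E_def)
  have E: "E \<in> carrier_mat 7 7"
    unfolding E_def by (intro mat_exp_carrier) (simp add: path_adj_mat_sq_carrier)
  have split: "map_vec complex_of_real ?p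
      = (1 / 2) \<cdot>\<^sub>v (map_vec complex_of_real (r (sqrt 2)) + map_vec complex_of_real (r (- sqrt 2)))"
    by (rule eq_vecI) (auto simp: r_def)
  have "E *\<^sub>v map_vec complex_of_real ?p = g \<cdot>\<^sub>v map_vec complex_of_real ?p"
    unfolding split using E r_carrier
    by (simp add: mult_mat_vec[of _ 7 7] mult_add_distrib_mat_vec[of _ 7 7] Er
        smult_add_distrib_vec[of _ 7] smult_smult_assoc mult.commute)
  then show ?thesis
    using transfer_eigenvector[OF path_adj_mat_sq_carrier _ q, of "pi / sqrt 2"]
    unfolding E_def
    by (intro transfer_time_sum_diff[where n = 7 and g = g])
      (simp_all add: path_adj_mat_sq_carrier g_def)
qed

section \<open>Classification and minimum times\<close>

theorem theorem5p11:
  fixes n a b :: nat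
  assumes "n \<ge> 2" and "a \<in> {1..n}" and "b \<in> {1..n}" and "a \<noteq> b"
  shows "(PST (path_adj_mat n ^\<^sub>m 2) a b \<longleftrightarrow>
            (n = 3 \<and> {a, b} = {1, 3}) \<or>
            (n = 5 \<and> {a, b} = {2, 4}) \<or>
            (n = 7 \<and> {a, b} = {2, 6}))
       \<and> (n = 3 \<and> {a, b} = {1, 3} \<longrightarrow> min_transfer_time (path_adj_mat n ^\<^sub>m 2) a b (pi / 2))
       \<and> (n = 5 \<and> {a, b} = {2, 4} \<longrightarrow> min_transfer_time (path_adj_mat n ^\<^sub>m 2) a b (pi / 2))
       \<and> (n = 7 \<and> {a, b} = {2, 6} \<longrightarrow> min_transfer_time (path_adj_mat n ^\<^sub>m 2) a b (pi / sqrt 2))"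
proof -
  let ?K = "path_adj_mat n ^\<^sub>m 2"
  \<comment> \<open>Bundling the time bounds with the classification yields both the forward
    implication and minimality.\<close>
  have necessary: "(n = 3 \<and> {a, b} = {1, 3} \<and> pi / 2 \<le> \<tau>) \<or> (n = 5 \<and> {a, b} = {2, 4} \<and> pi / 2 \<le> \<tau>)
      \<or> (n = 7 \<and> {a, b} = {2, 6} \<and> pi / sqrt 2 \<le> \<tau>)" if tr: "transfer_time ?K a b \<tau>" for \<tau>
  proof -
    have \<tau>: "\<tau> > 0" using tr by (simp add: transfer_time_def)
    obtain m where m: "n + 1 = 2 * m" and sum: "a + b = 2 * m"
      and phase: "\<And>k. \<not> 2 * m dvd k * a \<Longrightarrow> \<exists>q :: int.
        2 * \<tau> * (cos (pi / m) - cos (real k * pi / m)) = q * pi \<and> (even q \<longleftrightarrow> odd k)"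
      using path_transfer_time_phases[OF assms(2-4) tr] by metis
    \<comment> \<open>This is the phase condition for \<open>k = 2\<close>. The values of
      \<open>D\<close> for \<open>m = 2, 3, 4\<close> are 2, 2 and \<open>sqrt 2\<close>.\<close>
    have bound: "pi / D \<le> \<tau>" if nd: "\<not> 2 * m dvd 2 * a" and D: "D = 2 * (cos (pi / m) - cos (2 * pi / m))" "D > 0" for D
    proof -
      obtain q :: int where "2 * \<tau> * (cos (pi / m) - cos (2 * pi / m)) = q * pi"
        using phase[OF nd] by auto
      then have "\<tau> * D = q * pi" unfolding D(1) by (simp add: algebra_simps)
      then show ?thesis by (rule transfer_time_lower_bound[OF \<tau> D(2)])
    qed
    consider (2) "m = 2" "a \<in> {1, 3}" | (3) "m = 3" "a \<in> {2, 4}" | (4) "m = 4" "a \<in> {2, 6}"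
      using phase_condition_solutions[of a m \<tau>, OF _ _ _ \<tau> phase] assms m sum by auto
    then show ?thesis
    proof cases
      case 2
      then have "pi / 2 \<le> \<tau>" by (intro bound) auto
      then show ?thesis using 2 m sum by auto
    next
      case 3
      then have "pi / 1 \<le> 2 * \<tau>" using bound[of 2] cos_60 cos_120 by auto
      then show ?thesis using 3 m sum by auto
    next
      case 4
      then have "pi / sqrt 2 \<le> \<tau>" by (intro bound) (auto simp: cos_45)
      then show ?thesis using 4 m sum by auto
    qed
  qed
  have P3: "transfer_time ?K a b (pi / 2)" if "n = 3" "{a, b} = {1, 3}"
    using that transfer_time_P3 by (auto simp: doubleton_eq_iff)
  have P5: "transfer_time ?K a b (pi / 2)" if "n = 5" "{a, b} = {2, 4}"
    using that transfer_time_P5 by (auto simp: doubleton_eq_iff)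
  have P7: "transfer_time ?K a b (pi / sqrt 2)" if "n = 7" "{a, b} = {2, 6}"
    using that transfer_time_P7 by (auto simp: doubleton_eq_iff)
  show ?thesis
  proof (intro conjI impI)
    show "PST ?K a b \<longleftrightarrow> (n = 3 \<and> {a, b} = {1, 3}) \<or> (n = 5 \<and> {a, b} = {2, 4}) \<or> (n = 7 \<and> {a, b} = {2, 6})"
      (is "_ \<longleftrightarrow> ?R")
    proof
      assume "PST ?K a b"
      then obtain \<tau> where "transfer_time ?K a b \<tau>" unfolding PST_def by blast
      from necessary[OF this] show ?R by argo
    next
      assume ?R
      then show "PST ?K a b" unfolding PST_def by (elim disjE conjE) (rule exI, erule (1) P3 P5 P7)+
    qed
  next
    assume *: "n = 3 \<and> {a, b} = {1, 3}"
    have "pi / 2 \<le> \<tau>" if "transfer_time ?K a b \<tau>" for \<tau>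
      using necessary[OF that] * by simp
    then show "min_transfer_time ?K a b (pi / 2)"
      unfolding min_transfer_time_def using P3 * by blast
  next
    assume *: "n = 5 \<and> {a, b} = {2, 4}"
    have "pi / 2 \<le> \<tau>" if "transfer_time ?K a b \<tau>" for \<tau>
      using necessary[OF that] * by simp
    then show "min_transfer_time ?K a b (pi / 2)"
      unfolding min_transfer_time_def using P5 * by blast
  next
    assume *: "n = 7 \<and> {a, b} = {2, 6}"
    have "pi / sqrt 2 \<le> \<tau>" if "transfer_time ?K a b \<tau>" for \<tau>
      using necessary[OF that] * by simp
    then show "min_transfer_time ?K a b (pi / sqrt 2)"
      unfolding min_transfer_time_def using P7 * by blast
  qed
qed

end
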